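(* Assume the set of atoms is finite. For every $E\in\mathcal{L}({\sf par})$, the unification type of the logic ${\sf IPC}+E$ is finitary: every formula $A$ that is unifiable in ${\sf IPC}+E$ has a finite complete set of unifiers in ${\sf IPC}+E$.
   Context: The language $\mathcal{L}$ is built from atoms ${\sf atom}={\sf var}\cup{\sf par}$ (variables and parameters, disjoint) using $\bot,\wedge,\vee,\to$; here ${\sf atom}$ is assumed finite. $\mathcal{L}({\sf par})$ is the set of formulas whose atoms are all parameters. A substitution is a map $\theta:\mathcal{L}\to\mathcal{L}$ commuting with connectives with $\theta(p)=p$ for $p\in{\sf par}$; $\theta\gamma$ denotes composition. ${\sf IPC}+E$ is intuitionistic propositional logic with the single extra axiom $E$ (not as a schema); so ${\sf IPC}+E\vdash C$ iff $E\to C$ is intuitionistically provable. A unifier of $A$ in ${\sf IPC}+E$ is a substitution $\theta$ with ${\sf IPC}+E\vdash\theta(A)$; $A$ is unifiable if it has a unifier. $\gamma$ is less general than $\theta$ if there is a substitution $\lambda$ with ${\sf IPC}+E\vdash\gamma(x)\leftrightarrow\lambda\theta(x)$ for every variable $x$. A set $\Theta$ of substitutions is a complete set of unifiers of $A$ if every member unifies $A$ and every unifier of $A$ is less general than some member of $\Theta$. The unification type is finitary if every unifiable formula has a finite complete set of unifiers. *)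

theory Defs
  imports "HOL-Library.FuncSet"
begin

datatype (atoms: 'a) fm =
    Atom 'a
  | Bot  ("\<^bold>\<bottom>")
  | And "'a fm" "'a fm"  (infixr "\<^bold>\<and>" 75)
  | Or "'a fm" "'a fm"  (infixr "\<^bold>\<or>" 70)
  | Imp "'a fm" "'a fm"  (infixr "\<^bold>\<longrightarrow>" 65)

abbreviation Iff :: "'a fm \<Rightarrow> 'a fm \<Rightarrow> 'a fm"  (infix "\<^bold>\<longleftrightarrow>" 60)
  where "A \<^bold>\<longleftrightarrow> B \<equiv> (A \<^bold>\<longrightarrow> B) \<^bold>\<and> (B \<^bold>\<longrightarrow> A)"

definition lang :: "'a set \<Rightarrow> 'a fm set"
  where "lang X = {A. atoms A \<subseteq> X}"

text \<open>Theorems of IPC + E in a Hilbert calculus. All axioms but \<open>E\<close> are schematic; \<open>E\<close> itself is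
  not closed under substitution. Derivations may pass through atoms outside the language under
  consideration; this proves nothing new about formulas of the language, since such atoms can be
  replaced by falsum throughout a derivation.\<close>

inductive ipc_plus :: "'a fm \<Rightarrow> 'a fm \<Rightarrow> bool"  ("IPC+_ \<turnstile> _" [100, 55] 55)
  for E :: "'a fm"
where
  axiom_E: "IPC+E \<turnstile> E"
| imp_K: "IPC+E \<turnstile> A \<^bold>\<longrightarrow> B \<^bold>\<longrightarrow> A"
| imp_S: "IPC+E \<turnstile> (A \<^bold>\<longrightarrow> B \<^bold>\<longrightarrow> C) \<^bold>\<longrightarrow> (A \<^bold>\<longrightarrow> B) \<^bold>\<longrightarrow> A \<^bold>\<longrightarrow> C"
| and_left: "IPC+E \<turnstile> A \<^bold>\<and> B \<^bold>\<longrightarrow> A"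
| and_right: "IPC+E \<turnstile> A \<^bold>\<and> B \<^bold>\<longrightarrow> B"
| and_intro: "IPC+E \<turnstile> A \<^bold>\<longrightarrow> B \<^bold>\<longrightarrow> A \<^bold>\<and> B"
| or_left: "IPC+E \<turnstile> A \<^bold>\<longrightarrow> A \<^bold>\<or> B"
| or_right: "IPC+E \<turnstile> B \<^bold>\<longrightarrow> A \<^bold>\<or> B"
| or_elim: "IPC+E \<turnstile> (A \<^bold>\<longrightarrow> C) \<^bold>\<longrightarrow> (B \<^bold>\<longrightarrow> C) \<^bold>\<longrightarrow> A \<^bold>\<or> B \<^bold>\<longrightarrow> C"
| ex_falso: "IPC+E \<turnstile> \<^bold>\<bottom> \<^bold>\<longrightarrow> A"
| modus_ponens: "IPC+E \<turnstile> A \<^bold>\<longrightarrow> B \<Longrightarrow> IPC+E \<turnstile> A \<Longrightarrow> IPC+E \<turnstile> B"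

text \<open>A substitution is a map on the language over \<open>var \<union> par\<close>; its values on formulas outside that
  language are irrelevant.\<close>

definition substitution :: "'a set \<Rightarrow> 'a set \<Rightarrow> ('a fm \<Rightarrow> 'a fm) \<Rightarrow> bool"
  where "substitution var par \<theta> \<longleftrightarrow>
    \<theta> \<in> lang (var \<union> par) \<rightarrow> lang (var \<union> par) \<and>
    \<theta> \<^bold>\<bottom> = \<^bold>\<bottom> \<and>
    (\<forall>A\<in>lang (var \<union> par). \<forall>B\<in>lang (var \<union> par).
      \<theta> (A \<^bold>\<and> B) = \<theta> A \<^bold>\<and> \<theta> B \<and>
      \<theta> (A \<^bold>\<or> B) = \<theta> A \<^bold>\<or> \<theta> B \<and>
      \<theta> (A \<^bold>\<longrightarrow> B) = (\<theta> A \<^bold>\<longrightarrow> \<theta> B)) \<and>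
    (\<forall>p\<in>par. \<theta> (Atom p) = Atom p)"

definition unifier :: "'a set \<Rightarrow> 'a set \<Rightarrow> 'a fm \<Rightarrow> 'a fm \<Rightarrow> ('a fm \<Rightarrow> 'a fm) \<Rightarrow> bool"
  where "unifier var par E A \<theta> \<longleftrightarrow> substitution var par \<theta> \<and> IPC+E \<turnstile> \<theta> A"

definition unifiable :: "'a set \<Rightarrow> 'a set \<Rightarrow> 'a fm \<Rightarrow> 'a fm \<Rightarrow> bool"
  where "unifiable var par E A \<longleftrightarrow> (\<exists>\<theta>. unifier var par E A \<theta>)"

definition less_general ::
    "'a set \<Rightarrow> 'a set \<Rightarrow> 'a fm \<Rightarrow> ('a fm \<Rightarrow> 'a fm) \<Rightarrow> ('a fm \<Rightarrow> 'a fm) \<Rightarrow> bool"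
  where "less_general var par E \<gamma> \<theta> \<longleftrightarrow>
    (\<exists>\<sigma>. substitution var par \<sigma> \<and>
      (\<forall>x\<in>var. IPC+E \<turnstile> \<gamma> (Atom x) \<^bold>\<longleftrightarrow> (\<sigma> \<circ> \<theta>) (Atom x)))"

definition complete_unifiers ::
    "'a set \<Rightarrow> 'a set \<Rightarrow> 'a fm \<Rightarrow> 'a fm \<Rightarrow> ('a fm \<Rightarrow> 'a fm) set \<Rightarrow> bool"
  where "complete_unifiers var par E A \<Theta> \<longleftrightarrow>
    (\<forall>\<theta>\<in>\<Theta>. unifier var par E A \<theta>) \<and>
    (\<forall>\<gamma>. unifier var par E A \<gamma> \<longrightarrow> (\<exists>\<theta>\<in>\<Theta>. less_general var par E \<gamma> \<theta>))"

definition finitary_unification :: "'a set \<Rightarrow> 'a set \<Rightarrow> 'a fm \<Rightarrow> bool"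
  where "finitary_unification var par E \<longleftrightarrow>
    (\<forall>A\<in>lang (var \<union> par). unifiable var par E A \<longrightarrow>
      (\<exists>\<Theta>. finite \<Theta> \<and> complete_unifiers var par E A \<Theta>))"

end

theory Submission
  imports Defs
begin

text \<open>The unifiers are found with Kripke models, following Ghilardi. Call \<open>P\<close> extensible if, whenever a
  model of \<open>E\<close> forces \<open>P\<close> everywhere above its root, the variables (not the parameters) at the root
  can be revalued so that the root forces \<open>P\<close> as well. An extensible \<open>P\<close> is projective: composing the
  substitutions \<open>x \<mapsto> (P \<rightarrow> x)\<close> for \<open>x \<in> a\<close>, \<open>x \<mapsto> (P \<and> x)\<close> for \<open>x \<notin> a\<close> sufficiently often over all sets \<open>a\<close>
  of variables yields a unifier \<open>\<theta>\<close> of \<open>P\<close> that is the identity modulo \<open>P\<close>, hence is more general than any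
  unifier of \<open>P\<close>. Conversely, for a unifier \<open>\<gamma>\<close> of \<open>A\<close> let \<open>P\<close> define, up to implication depth \<open>n\<close>, the
  models that \<open>\<gamma>\<close> makes out of models of \<open>E\<close>: it is extensible, implies \<open>A\<close> and is unified by \<open>\<gamma>\<close>.
  As \<open>n\<close> depends only on \<open>A\<close> and \<open>E\<close>, only finitely many \<open>P\<close> occur up to equivalence.\<close>

section \<open>Kripke models as finite trees\<close>

text \<open>The worlds of a tree model are its subtrees.\<close>

datatype 'a ktree = Node (lab: "'a set") (kids: "'a ktree list")

fun up :: "'a ktree \<Rightarrow> 'a ktree set"
  where "up (Node L ts) = insert (Node L ts) (\<Union>t\<in>set ts. up t)"

definition above :: "'a ktree \<Rightarrow> 'a ktree set"
  where "above t = (\<Union>s\<in>set (kids t). up s)"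

fun pers :: "'a ktree \<Rightarrow> bool"
  where "pers (Node L ts) \<longleftrightarrow> (\<forall>t\<in>set ts. L \<subseteq> lab t \<and> pers t)"

primrec forces :: "'a ktree \<Rightarrow> 'a fm \<Rightarrow> bool"  (infix "\<tturnstile>" 50)
  where
    "t \<tturnstile> Atom x \<longleftrightarrow> x \<in> lab t"
  | "t \<tturnstile> \<^bold>\<bottom> \<longleftrightarrow> False"
  | "t \<tturnstile> B \<^bold>\<and> C \<longleftrightarrow> t \<tturnstile> B \<and> t \<tturnstile> C"
  | "t \<tturnstile> B \<^bold>\<or> C \<longleftrightarrow> t \<tturnstile> B \<or> t \<tturnstile> C"
  | "t \<tturnstile> B \<^bold>\<longrightarrow> C \<longleftrightarrow> (\<forall>s\<in>up t. s \<tturnstile> B \<longrightarrow> s \<tturnstile> C)"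

lemma up_eq: "up t = insert t (above t)"
  by (cases t) (simp add: above_def)

lemma up_refl [simp]: "t \<in> up t"
  by (simp add: up_eq)

lemma up_trans: "s \<in> up t \<Longrightarrow> u \<in> up s \<Longrightarrow> u \<in> up t"
  by (induction t arbitrary: s u) auto

lemma above_Node [simp]: "above (Node L ts) = (\<Union>t\<in>set ts. up t)"
  by (simp add: above_def)

lemma above_up: "s \<in> above t \<Longrightarrow> s \<in> up t"
  by (simp add: up_eq)

lemma above_trans: "s \<in> above t \<Longrightarrow> u \<in> up s \<Longrightarrow> u \<in> above t"
  by (auto simp: above_def intro: up_trans)

lemma finite_up [simp]: "finite (up t)"
  by (induction t) auto

lemma finite_above [simp]: "finite (above t)"
  by (simp add: above_def)

lemma pers_up: "pers t \<Longrightarrow> s \<in> up t \<Longrightarrow> pers s \<and> lab t \<subseteq> lab s"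
proof (induction t arbitrary: s)
  case (Node L ts)
  then show ?case by (cases "s = Node L ts") (auto, blast)
qed

text \<open>Isolates the condition on the root label, so that a root relabelled over the same
  children is checked only against the worlds strictly above it.\<close>

lemma pers_iff: "pers (Node L ts) \<longleftrightarrow> (\<forall>t\<in>set ts. pers t) \<and> (\<forall>t\<in>above (Node L ts). L \<subseteq> lab t)"
proof (intro iffI conjI ballI)
  fix s assume *: "pers (Node L ts)" "s \<in> above (Node L ts)"
  show "L \<subseteq> lab s" using pers_up[OF *(1) above_up[OF *(2)]] by simp
next
  assume *: "(\<forall>t\<in>set ts. pers t) \<and> (\<forall>t\<in>above (Node L ts). L \<subseteq> lab t)"
  have "L \<subseteq> lab t" if "t \<in> set ts" for t
  proof -
    have "t \<in> above (Node L ts)" unfolding above_Node by (rule UN_I[OF that up_refl])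
    then show ?thesis using * by blast
  qed
  then show "pers (Node L ts)" using * by simp
qed simp

lemma forces_up: "t \<tturnstile> B \<Longrightarrow> pers t \<Longrightarrow> s \<in> up t \<Longrightarrow> s \<tturnstile> B"
proof (induction B arbitrary: t s)
  case (Atom x)
  then show ?case using pers_up by auto
next
  case (Imp B C)
  then show ?case by (auto intro: up_trans)
qed auto

section \<open>Soundness and completeness\<close>

lemma soundness:
  assumes "IPC+E \<turnstile> B" "pers t" "t \<tturnstile> E"
  shows "t \<tturnstile> B"
  using assms
proof (induction arbitrary: t)
  case axiom_E
  then show ?case by simp
next
  case (imp_K A B)
  then show ?case using forces_up pers_up by (metis forces.simps(5))
next
  case (imp_S A B C)
  show ?case unfolding forces.simps by (meson up_refl up_trans)
next
  case (and_intro A B)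
  show ?case unfolding forces.simps by (meson and_intro(1) forces_up pers_up)
next
  case (or_elim A C B)
  show ?case unfolding forces.simps by (meson up_refl up_trans)
next
  case (modus_ponens A B)
  then show ?case using up_refl by (metis forces.simps(5))
qed auto

section \<open>Derivations from hypotheses and the finite canonical model\<close>

inductive ded :: "'a fm \<Rightarrow> 'a fm set \<Rightarrow> 'a fm \<Rightarrow> bool"
  for E :: "'a fm" and \<Gamma> :: "'a fm set"
where
  hyp: "B \<in> \<Gamma> \<Longrightarrow> ded E \<Gamma> B"
| base: "IPC+E \<turnstile> B \<Longrightarrow> ded E \<Gamma> B"
| mp: "ded E \<Gamma> (B \<^bold>\<longrightarrow> C) \<Longrightarrow> ded E \<Gamma> B \<Longrightarrow> ded E \<Gamma> C"

lemma ded_empty: "ded E {} B \<Longrightarrow> IPC+E \<turnstile> B"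
  by (induction rule: ded.induct) (auto intro: modus_ponens)

lemma imp_refl: "IPC+E \<turnstile> A \<^bold>\<longrightarrow> A"
  using imp_K[of E A A] imp_K[of E A "A \<^bold>\<longrightarrow> A"] imp_S[of E A "A \<^bold>\<longrightarrow> A" A] modus_ponens by metis

lemma deduction: "ded E (insert A \<Gamma>) B \<Longrightarrow> ded E \<Gamma> (A \<^bold>\<longrightarrow> B)"
proof (induction rule: ded.induct)
  case (hyp B)
  then show ?case
    by (metis imp_K imp_refl ded.hyp ded.base ded.mp insertE)
next
  case (base B)
  then show ?case by (metis imp_K ded.base ded.mp)
next
  case (mp B C)
  then show ?case by (metis imp_S ded.base ded.mp)
qed

text \<open>Prime theories relative to \<open>S\<close>; for finite \<open>S\<close> closed under
  subformulas they are the worlds of the canonical model.\<close>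

definition theory_in :: "'a fm \<Rightarrow> 'a fm set \<Rightarrow> 'a fm set \<Rightarrow> bool"
  where "theory_in E S \<Gamma> \<longleftrightarrow> \<Gamma> \<subseteq> S \<and> (\<forall>B\<in>S. ded E \<Gamma> B \<longrightarrow> B \<in> \<Gamma>) \<and> \<not> ded E \<Gamma> \<^bold>\<bottom> \<and>
    (\<forall>B\<in>S. \<forall>C\<in>S. B \<^bold>\<or> C \<in> \<Gamma> \<longrightarrow> B \<in> \<Gamma> \<or> C \<in> \<Gamma>)"

text \<open>Lindenbaum's lemma inside \<open>S\<close>: take a maximal set that does not derive
  \<open>B\<close>. By the deduction theorem it makes every formula of \<open>S\<close> outside it
  imply \<open>B\<close>, which yields closure and primeness.\<close>

lemma theory_extension:
  assumes "finite S" "\<Gamma> \<subseteq> S" "\<not> ded E \<Gamma> B"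
  shows "\<exists>\<Delta>. theory_in E S \<Delta> \<and> \<Gamma> \<subseteq> \<Delta> \<and> \<not> ded E \<Delta> B"
proof -
  define F where "F = {\<Delta>. \<Gamma> \<subseteq> \<Delta> \<and> \<Delta> \<subseteq> S \<and> \<not> ded E \<Delta> B}"
  have "finite F" by (rule finite_subset[of _ "Pow S"]) (use assms(1) in \<open>auto simp: F_def\<close>)
  moreover have "\<Gamma> \<in> F" using assms by (auto simp: F_def)
  ultimately obtain \<Delta> where \<Delta>F: "\<Delta> \<in> F" and max: "\<forall>\<Delta>'\<in>F. \<Delta> \<subseteq> \<Delta>' \<longrightarrow> \<Delta> = \<Delta>'"
    by (auto dest: finite_has_maximal2)
  have \<Delta>: "\<Gamma> \<subseteq> \<Delta>" "\<Delta> \<subseteq> S" "\<not> ded E \<Delta> B" using \<Delta>F by (auto simp: F_def)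
  have ins: "ded E \<Delta> (C \<^bold>\<longrightarrow> B)" if "C \<in> S" "C \<notin> \<Delta>" for C
  proof (rule deduction, rule ccontr)
    assume "\<not> ded E (insert C \<Delta>) B"
    then have "insert C \<Delta> \<in> F" using \<Delta> that by (auto simp: F_def)
    then have "\<Delta> = insert C \<Delta>" using max by (auto dest!: bspec)
    then show False using that by auto
  qed
  have "C \<in> \<Delta>" if "C \<in> S" "ded E \<Delta> C" for C
    using ins[OF that(1)] that(2) \<Delta> ded.mp by blast
  moreover have "C \<in> \<Delta> \<or> D \<in> \<Delta>" if "C \<in> S" "D \<in> S" "C \<^bold>\<or> D \<in> \<Delta>" for C D
  proof (rule ccontr)
    assume "\<not> (C \<in> \<Delta> \<or> D \<in> \<Delta>)"
    then have "ded E \<Delta> (C \<^bold>\<longrightarrow> B)" "ded E \<Delta> (D \<^bold>\<longrightarrow> B)" using ins that by auto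
    then have "ded E \<Delta> B" using that(3) by (meson ded.intros or_elim)
    then show False using \<Delta> by simp
  qed
  moreover have "\<not> ded E \<Delta> \<^bold>\<bottom>"
    using \<Delta> by (auto intro: ded.mp[OF ded.base[OF ex_falso]])
  ultimately have "theory_in E S \<Delta>" using \<Delta> by (auto simp: theory_in_def)
  then show ?thesis using \<Delta> by auto
qed

primrec subfms :: "'a fm \<Rightarrow> 'a fm set"
  where
    "subfms (Atom x) = {Atom x}"
  | "subfms \<^bold>\<bottom> = {\<^bold>\<bottom>}"
  | "subfms (B \<^bold>\<and> C) = insert (B \<^bold>\<and> C) (subfms B \<union> subfms C)"
  | "subfms (B \<^bold>\<or> C) = insert (B \<^bold>\<or> C) (subfms B \<union> subfms C)"
  | "subfms (B \<^bold>\<longrightarrow> C) = insert (B \<^bold>\<longrightarrow> C) (subfms B \<union> subfms C)"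

lemma finite_subfms [simp]: "finite (subfms B)"
  by (induction B) auto

lemma subfms_refl [simp]: "B \<in> subfms B"
  by (cases B) auto

lemma subfms_trans: "C \<in> subfms B \<Longrightarrow> subfms C \<subseteq> subfms B"
  by (induction B) auto

text \<open>Unravels the canonical model: the children of the tree for \<open>\<Gamma>\<close> are
  the trees for all proper extensions of \<open>\<Gamma>\<close>. The recursion ends because
  \<open>S - \<Gamma>\<close> shrinks.\<close>

lemma canonical_tree:
  assumes "finite S" and sub: "\<And>B. B \<in> S \<Longrightarrow> subfms B \<subseteq> S" and "theory_in E S \<Gamma>"
  shows "\<exists>t. pers t \<and> (\<forall>B\<in>S. t \<tturnstile> B \<longleftrightarrow> B \<in> \<Gamma>)"
  using assms(3)
proof (induction "card (S - \<Gamma>)" arbitrary: \<Gamma> rule: less_induct)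
  case less
  let ?F = "{\<Delta>. theory_in E S \<Delta> \<and> \<Gamma> \<subset> \<Delta>}"
  have "\<exists>t. pers t \<and> (\<forall>B\<in>S. t \<tturnstile> B \<longleftrightarrow> B \<in> \<Delta>)" if "\<Delta> \<in> ?F" for \<Delta>
  proof -
    have "\<Delta> \<subseteq> S" using that by (auto simp: theory_in_def)
    then have "S - \<Delta> \<subset> S - \<Gamma>" using that by blast
    then have "card (S - \<Delta>) < card (S - \<Gamma>)" using assms(1) by (intro psubset_card_mono) auto
    then show ?thesis using less.hyps that by auto
  qed
  then obtain T where T: "\<And>\<Delta>. \<Delta> \<in> ?F \<Longrightarrow> pers (T \<Delta>)"
    "\<And>\<Delta> B. \<Delta> \<in> ?F \<Longrightarrow> B \<in> S \<Longrightarrow> T \<Delta> \<tturnstile> B \<longleftrightarrow> B \<in> \<Delta>"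
    by metis
  have "finite ?F"
    by (rule finite_subset[of _ "Pow S"]) (use assms(1) in \<open>auto simp: theory_in_def\<close>)
  then obtain ts where ts: "set ts = T ` ?F" by (metis finite_imageI finite_list)
  define t where "t = Node {x. Atom x \<in> \<Gamma>} ts"
  have \<Gamma>: "\<Gamma> \<subseteq> S" "\<And>B. B \<in> S \<Longrightarrow> ded E \<Gamma> B \<Longrightarrow> B \<in> \<Gamma>" "\<^bold>\<bottom> \<notin> \<Gamma>"
    "\<And>B C. B \<in> S \<Longrightarrow> C \<in> S \<Longrightarrow> B \<^bold>\<or> C \<in> \<Gamma> \<Longrightarrow> B \<in> \<Gamma> \<or> C \<in> \<Gamma>"
    using less.prems by (auto simp: theory_in_def intro: ded.hyp)
  have "pers t"
    unfolding t_def pers.simps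
  proof (intro ballI conjI subsetI)
    fix s x assume "s \<in> set ts" "x \<in> {x. Atom x \<in> \<Gamma>}"
    then obtain \<Delta> where "\<Delta> \<in> ?F" "s = T \<Delta>" "Atom x \<in> \<Gamma>" using ts by auto
    then have "s \<tturnstile> Atom x" using T(2) \<Gamma>(1) by blast
    then show "x \<in> lab s" by simp
  next
    fix s assume "s \<in> set ts"
    then show "pers s" using ts T(1) by auto
  qed
  moreover have "t \<tturnstile> B \<longleftrightarrow> B \<in> \<Gamma>" if "B \<in> S" for B
    using that
  proof (induction B)
    case (Atom x)
    then show ?case by (simp add: t_def)
  next
    case Bot
    then show ?case using \<Gamma>(3) by simp
  next
    case (And B C)
    have BC: "B \<in> S" "C \<in> S" using sub[OF And.prems] by auto
    have "B \<^bold>\<and> C \<in> \<Gamma> \<longleftrightarrow> B \<in> \<Gamma> \<and> C \<in> \<Gamma>"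
      using \<Gamma>(2) BC And.prems by (meson ded.intros and_left and_right and_intro)
    then show ?case using And BC by simp
  next
    case (Or B C)
    have BC: "B \<in> S" "C \<in> S" using sub[OF Or.prems] by auto
    have "B \<^bold>\<or> C \<in> \<Gamma> \<longleftrightarrow> B \<in> \<Gamma> \<or> C \<in> \<Gamma>"
      using \<Gamma>(2,4) BC Or.prems by (meson ded.intros or_left or_right)
    then show ?case using Or BC by simp
  next
    case (Imp B C)
    have BC: "B \<in> S" "C \<in> S" using sub[OF Imp.prems] by auto
    show ?case
    proof
      assume "B \<^bold>\<longrightarrow> C \<in> \<Gamma>"
      show "t \<tturnstile> B \<^bold>\<longrightarrow> C"
        unfolding forces.simps
      proof (intro ballI impI)
        fix s assume s: "s \<in> up t" "s \<tturnstile> B"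
        show "s \<tturnstile> C"
        proof (cases "s = t")
          case True
          then have "B \<in> \<Gamma>" using s Imp BC by simp
          then have "C \<in> \<Gamma>" using \<open>B \<^bold>\<longrightarrow> C \<in> \<Gamma>\<close> \<Gamma>(2) BC by (meson ded.intros)
          then show ?thesis using Imp BC True by simp
        next
          case False
          then obtain \<Delta> where \<Delta>: "\<Delta> \<in> ?F" "s \<in> up (T \<Delta>)" using s ts by (auto simp: t_def)
          then have "T \<Delta> \<tturnstile> B \<^bold>\<longrightarrow> C" using T(2) \<open>B \<^bold>\<longrightarrow> C \<in> \<Gamma>\<close> Imp.prems by blast
          then show ?thesis using \<Delta>(2) s(2) by simp
        qed
      qed
    next
      assume t: "t \<tturnstile> B \<^bold>\<longrightarrow> C"
      show "B \<^bold>\<longrightarrow> C \<in> \<Gamma>"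
      proof (rule ccontr)
        assume "B \<^bold>\<longrightarrow> C \<notin> \<Gamma>"
        then have "\<not> ded E (insert B \<Gamma>) C" using \<Gamma>(2) Imp.prems deduction by blast
        then obtain \<Delta> where \<Delta>: "theory_in E S \<Delta>" "insert B \<Gamma> \<subseteq> \<Delta>" "\<not> ded E \<Delta> C"
          using theory_extension[OF assms(1), of "insert B \<Gamma>" E C] \<Gamma>(1) BC by blast
        then have "C \<notin> \<Delta>" using ded.hyp by blast
        \<comment> \<open>The extension may coincide with \<open>\<Gamma>\<close>; then the root
          itself refutes the implication, and otherwise the child \<open>T \<Delta>\<close>
          does.\<close>
        show False
        proof (cases "\<Delta> = \<Gamma>")
          case True
          then show False using t \<Delta>(2) \<open>C \<notin> \<Delta>\<close> Imp.IH BC by auto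
        next
          case False
          then have F: "\<Delta> \<in> ?F" using \<Delta> by blast
          then have "T \<Delta> \<in> set ts" using ts by blast
          then have "T \<Delta> \<in> up t" using up_refl unfolding t_def up.simps by blast
          moreover have "T \<Delta> \<tturnstile> B" "\<not> T \<Delta> \<tturnstile> C" using T(2)[OF F] BC \<Delta>(2) \<open>C \<notin> \<Delta>\<close> by auto
          ultimately show False using t by auto
        qed
      qed
    qed
  qed
  ultimately show ?case by blast
qed

lemma completeness:
  assumes "\<And>t. pers t \<Longrightarrow> t \<tturnstile> E \<Longrightarrow> t \<tturnstile> B"
  shows "IPC+E \<turnstile> B"
proof (rule ccontr)
  assume "\<not> IPC+E \<turnstile> B"
  then have "\<not> ded E {} B" using ded_empty by blast
  define S where "S = subfms E \<union> subfms B"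
  have S: "finite S" "\<And>B. B \<in> S \<Longrightarrow> subfms B \<subseteq> S" "E \<in> S" "B \<in> S"
    using subfms_trans by (auto simp: S_def)
  obtain \<Delta> where \<Delta>: "theory_in E S \<Delta>" "\<not> ded E \<Delta> B"
    using theory_extension[OF S(1) _ \<open>\<not> ded E {} B\<close>] by auto
  obtain t where t: "pers t" "\<And>C. C \<in> S \<Longrightarrow> t \<tturnstile> C \<longleftrightarrow> C \<in> \<Delta>"
    using canonical_tree[OF S(1,2) \<Delta>(1)] by blast
  have "E \<in> \<Delta>" using \<Delta>(1) S(3) by (auto simp: theory_in_def intro: ded.base axiom_E)
  moreover have "B \<notin> \<Delta>" using \<Delta>(2) ded.hyp by blast
  ultimately show False using assms[OF t(1)] t(2) S(3,4) by auto
qed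

section \<open>Substitutions acting on models\<close>

primrec subst :: "('a \<Rightarrow> 'a fm) \<Rightarrow> 'a fm \<Rightarrow> 'a fm"
  where
    "subst f (Atom x) = f x"
  | "subst f \<^bold>\<bottom> = \<^bold>\<bottom>"
  | "subst f (B \<^bold>\<and> C) = subst f B \<^bold>\<and> subst f C"
  | "subst f (B \<^bold>\<or> C) = subst f B \<^bold>\<or> subst f C"
  | "subst f (B \<^bold>\<longrightarrow> C) = subst f B \<^bold>\<longrightarrow> subst f C"

fun act :: "('a \<Rightarrow> 'a fm) \<Rightarrow> 'a ktree \<Rightarrow> 'a ktree"
  where "act f (Node L ts) = Node {x. Node L ts \<tturnstile> f x} (map (act f) ts)"

lemma lab_act [simp]: "lab (act f t) = {x. t \<tturnstile> f x}"
  by (cases t) simp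

lemma up_act: "up (act f t) = act f ` up t"
  by (induction t) auto

text \<open>By soundness and completeness, \<open>subst f B\<close> is a theorem of IPC +
  \<open>E\<close> iff \<open>act f\<close> sends every persistent model of \<open>E\<close> to a
  model of \<open>B\<close>. Unification is treated in this form below.\<close>

lemma forces_subst: "t \<tturnstile> subst f B \<longleftrightarrow> act f t \<tturnstile> B"
  by (induction B arbitrary: t) (auto simp: up_act)

lemma pers_act: "pers t \<Longrightarrow> pers (act f t)"
proof (induction t)
  case (Node L ts)
  have "u \<tturnstile> f x" if "Node L ts \<tturnstile> f x" "u \<in> set ts" for u x
    using that forces_up[OF _ Node.prems, of "f x" u] by (auto intro: up_refl)
  then show ?case using Node by auto
qed

text \<open>Composition is contravariant: \<open>f\<close>, which acts first on the model, is
  substituted into the values of \<open>g\<close>.\<close>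

lemma act_act: "act g (act f t) = act (\<lambda>x. subst f (g x)) t"
  by (induction t) (auto simp: forces_subst)

lemma subst_cong: "(\<And>x. x \<in> atoms B \<Longrightarrow> f x = g x) \<Longrightarrow> subst f B = subst g B"
  by (induction B) auto

lemma subst_Atom [simp]: "subst Atom B = B"
  by (induction B) auto

lemma subst_lang: "B \<in> lang X \<Longrightarrow> (\<And>x. x \<in> X \<Longrightarrow> f x \<in> lang Y) \<Longrightarrow> subst f B \<in> lang Y"
  by (induction B) (auto simp: lang_def)

lemma subst_id: "B \<in> lang X \<Longrightarrow> (\<And>x. x \<in> X \<Longrightarrow> f x = Atom x) \<Longrightarrow> subst f B = B"
  using subst_cong[of B f Atom] by (auto simp: lang_def)

section \<open>Formulas of bounded implication depth\<close>

primrec depth :: "'a fm \<Rightarrow> nat"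
  where
    "depth (Atom x) = 0"
  | "depth \<^bold>\<bottom> = 0"
  | "depth (B \<^bold>\<and> C) = max (depth B) (depth C)"
  | "depth (B \<^bold>\<or> C) = max (depth B) (depth C)"
  | "depth (B \<^bold>\<longrightarrow> C) = Suc (max (depth B) (depth C))"

definition fms :: "'a set \<Rightarrow> nat \<Rightarrow> 'a fm set"
  where "fms X n = {B \<in> lang X. depth B \<le> n}"

definition agree :: "'a fm set \<Rightarrow> 'a ktree \<Rightarrow> 'a ktree \<Rightarrow> bool"
  where "agree S s t \<longleftrightarrow> (\<forall>B\<in>S. s \<tturnstile> B \<longleftrightarrow> t \<tturnstile> B)"

definition equiv_fm :: "'a fm \<Rightarrow> 'a fm \<Rightarrow> bool"
  where "equiv_fm B C \<longleftrightarrow> (\<forall>t. t \<tturnstile> B \<longleftrightarrow> t \<tturnstile> C)"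

definition represents :: "'a fm set \<Rightarrow> 'a fm set \<Rightarrow> bool"
  where "represents R S \<longleftrightarrow> finite R \<and> R \<subseteq> S \<and> (\<forall>B\<in>S. \<exists>C\<in>R. equiv_fm B C)"

lemma fms_simps [simp]:
  "Atom x \<in> fms X n \<longleftrightarrow> x \<in> X"
  "\<^bold>\<bottom> \<in> fms X n"
  "B \<^bold>\<and> C \<in> fms X n \<longleftrightarrow> B \<in> fms X n \<and> C \<in> fms X n"
  "B \<^bold>\<or> C \<in> fms X n \<longleftrightarrow> B \<in> fms X n \<and> C \<in> fms X n"
  "B \<^bold>\<longrightarrow> C \<in> fms X (Suc n) \<longleftrightarrow> B \<in> fms X n \<and> C \<in> fms X n"
  "B \<^bold>\<longrightarrow> C \<notin> fms X 0"
  by (auto simp: fms_def lang_def)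

lemma fms_mono: "B \<in> fms X m \<Longrightarrow> m \<le> n \<Longrightarrow> B \<in> fms X n"
  by (auto simp: fms_def)

lemma fms_Suc: "B \<in> fms X n \<Longrightarrow> B \<in> fms X (Suc n)"
  by (simp add: fms_def)

lemma agree_sym: "agree S s t \<Longrightarrow> agree S t s"
  by (simp add: agree_def)

lemma agree_trans: "agree S s t \<Longrightarrow> agree S t u \<Longrightarrow> agree S s u"
  by (simp add: agree_def)

lemma agree_represents: "represents R S \<Longrightarrow> agree R s t \<longleftrightarrow> agree S s t"
  unfolding represents_def agree_def equiv_fm_def by (meson subsetD)

text \<open>\<open>f B\<close> collects the truth patterns on \<open>L\<close> realized by trees
  forcing \<open>B\<close>. It determines \<open>B\<close> up to equivalence and takes finitely many
  values, so one formula per value suffices.\<close>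

lemma represents_of_finitely_determined:
  assumes "finite L" and "\<And>B s t. B \<in> S \<Longrightarrow> agree L s t \<Longrightarrow> s \<tturnstile> B \<Longrightarrow> t \<tturnstile> B"
  shows "\<exists>R. represents R S"
proof -
  define f where "f = (\<lambda>B. (\<lambda>t. {G \<in> L. t \<tturnstile> G}) ` {t. t \<tturnstile> B})"
  have "f ` S \<subseteq> Pow (Pow L)" by (auto simp: f_def)
  then have "finite (f ` S)" using assms(1) by (auto intro: finite_subset)
  then obtain R where R: "R \<subseteq> S" "finite R" "f ` S = f ` R"
    using finite_subset_image[of "f ` S" f S] by auto
  have "equiv_fm B C" if "B \<in> S" "C \<in> S" "f B = f C" for B C
  proof -
    have "t \<tturnstile> C'" if "B' \<in> S" "C' \<in> S" "f B' = f C'" "t \<tturnstile> B'" for t B' C'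
    proof -
      have "{G \<in> L. t \<tturnstile> G} \<in> f C'" using that by (auto simp: f_def)
      then obtain s where "s \<tturnstile> C'" "{G \<in> L. t \<tturnstile> G} = {G \<in> L. s \<tturnstile> G}" by (auto simp: f_def)
      moreover from this have "agree L s t" by (auto simp: agree_def)
      ultimately show ?thesis using assms(2) that(2) by blast
    qed
    then show ?thesis using that unfolding equiv_fm_def by metis
  qed
  note eq = this
  have "\<exists>C\<in>R. equiv_fm B C" if "B \<in> S" for B
  proof -
    have "f B \<in> f ` R" using R(3) that by blast
    then obtain C where "C \<in> R" "f B = f C" by blast
    then show ?thesis using eq[OF that] R(1) by blast
  qed
  then show ?thesis using R(1,2) by (auto simp: represents_def)
qed

text \<open>A formula of depth at most \<open>n + 1\<close> is a combination by conjunction and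
  disjunction of falsum, atoms and implications between formulas of depth at most \<open>n\<close>;
  the two sides of the latter can be replaced by representatives.\<close>

lemma fms_represented:
  assumes "finite X"
  shows "\<exists>R. represents R (fms X n)"
proof (induction n)
  case 0
  show ?case
  proof (rule represents_of_finitely_determined[of "Atom ` X"])
    fix B :: "'a fm" and s t
    assume "B \<in> fms X 0" and a: "agree (Atom ` X) s t" and "s \<tturnstile> B"
    have "s \<tturnstile> B \<longleftrightarrow> t \<tturnstile> B" using \<open>B \<in> fms X 0\<close>
      by (induction B) (use a in \<open>auto simp: agree_def\<close>)
    then show "t \<tturnstile> B" using \<open>s \<tturnstile> B\<close> by simp
  qed (use assms in simp)
next
  case (Suc n)
  then obtain R where R: "represents R (fms X n)" by blast
  define L where "L = Atom ` X \<union> (\<lambda>(B, C). B \<^bold>\<longrightarrow> C) ` (R \<times> R)"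
  show ?case
  proof (rule represents_of_finitely_determined[of L])
    show "finite L" using R assms by (auto simp: L_def represents_def)
    fix B :: "'a fm" and s t
    assume "B \<in> fms X (Suc n)" and a: "agree L s t" and "s \<tturnstile> B"
    have "s \<tturnstile> B \<longleftrightarrow> t \<tturnstile> B" using \<open>B \<in> fms X (Suc n)\<close>
    proof (induction B)
      case (Atom x)
      then have "Atom x \<in> L" by (auto simp: L_def)
      then show ?case using a by (simp only: agree_def)
    next
      case (Imp B C)
      then obtain B' C' where BC: "B' \<in> R" "C' \<in> R" "equiv_fm B B'" "equiv_fm C C'"
        using R unfolding represents_def fms_simps by meson
      then have "B' \<^bold>\<longrightarrow> C' \<in> L" by (auto simp: L_def)
      then have "s \<tturnstile> B' \<^bold>\<longrightarrow> C' \<longleftrightarrow> t \<tturnstile> B' \<^bold>\<longrightarrow> C'" using a by (simp only: agree_def)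
      then show ?case using BC(3,4) by (simp add: equiv_fm_def)
    qed auto
    then show "t \<tturnstile> B" using \<open>s \<tturnstile> B\<close> by simp
  qed
qed

lemma finite_conj:
  assumes "finite S" "S \<subseteq> fms X (Suc n)"
  shows "\<exists>C\<in>fms X (Suc n). \<forall>t. t \<tturnstile> C \<longleftrightarrow> (\<forall>B\<in>S. t \<tturnstile> B)"
  using assms
proof (induction S)
  case empty
  \<comment> \<open>The empty conjunction must be true everywhere, which takes an implication; hence
    the bound \<open>Suc n\<close>.\<close>
  show ?case by (intro bexI[of _ "\<^bold>\<bottom> \<^bold>\<longrightarrow> \<^bold>\<bottom>"]) auto
next
  case (insert B S)
  then obtain C where "C \<in> fms X (Suc n)" "\<forall>t. t \<tturnstile> C \<longleftrightarrow> (\<forall>B\<in>S. t \<tturnstile> B)" by auto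
  then show ?case using insert.prems by (intro bexI[of _ "B \<^bold>\<and> C"]) auto
qed

lemma finite_disj:
  assumes "finite S" "S \<subseteq> fms X n"
  shows "\<exists>C\<in>fms X n. \<forall>t. t \<tturnstile> C \<longleftrightarrow> (\<exists>B\<in>S. t \<tturnstile> B)"
  using assms
proof (induction S)
  case empty
  show ?case by (intro bexI[of _ "\<^bold>\<bottom>"]) auto
next
  case (insert B S)
  then obtain C where "C \<in> fms X n" "\<forall>t. t \<tturnstile> C \<longleftrightarrow> (\<exists>B\<in>S. t \<tturnstile> B)" by auto
  then show ?case using insert.prems by (intro bexI[of _ "B \<^bold>\<or> C"]) auto
qed

section \<open>Comparing models up to bounded depth\<close>

definition below :: "'a fm set \<Rightarrow> 'a ktree \<Rightarrow> 'a ktree \<Rightarrow> bool"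
  where "below S t u \<longleftrightarrow> (\<forall>B\<in>S. u \<tturnstile> B \<longrightarrow> t \<tturnstile> B)"

text \<open>Let \<open>C\<close> be the conjunction of the representatives true at \<open>w\<close>,
  and \<open>D\<close> the disjunction of those false at \<open>w\<close>. The implication from
  \<open>C\<close> to \<open>D\<close> fails at \<open>t\<close>, hence at \<open>u\<close>, and a
  world over \<open>u\<close> that forces \<open>C\<close> but not \<open>D\<close> agrees with
  \<open>w\<close>.\<close>

lemma below_forward:
  assumes "finite X" "below (fms X (Suc (Suc k))) t u" "w \<in> up t"
  shows "\<exists>v\<in>up u. agree (fms X (Suc k)) w v"
proof -
  obtain R where R: "represents R (fms X (Suc k))" using fms_represented[OF assms(1)] by blast
  then have fin: "finite {B \<in> R. Q B}" "{B \<in> R. Q B} \<subseteq> fms X (Suc k)" for Q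
    by (auto simp: represents_def)
  obtain C where C: "C \<in> fms X (Suc k)" "\<forall>t. t \<tturnstile> C \<longleftrightarrow> (\<forall>B\<in>{B \<in> R. w \<tturnstile> B}. t \<tturnstile> B)"
    using finite_conj[OF fin[of "\<lambda>B. w \<tturnstile> B"]] by (elim bexE)
  obtain D where D: "D \<in> fms X (Suc k)" "\<forall>t. t \<tturnstile> D \<longleftrightarrow> (\<exists>B\<in>{B \<in> R. \<not> w \<tturnstile> B}. t \<tturnstile> B)"
    using finite_disj[OF fin[of "\<lambda>B. \<not> w \<tturnstile> B"]] by (elim bexE)
  have "\<not> t \<tturnstile> C \<^bold>\<longrightarrow> D" using assms(3) C(2) D(2) by auto
  moreover have "C \<^bold>\<longrightarrow> D \<in> fms X (Suc (Suc k))" using C(1) D(1) by simp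
  ultimately have "\<not> u \<tturnstile> C \<^bold>\<longrightarrow> D" using assms(2) unfolding below_def by blast
  then obtain v where "v \<in> up u" "v \<tturnstile> C" "\<not> v \<tturnstile> D" by auto
  moreover from this have "agree R w v" using C(2) D(2) by (auto simp: agree_def)
  ultimately show ?thesis using agree_represents[OF R] by blast
qed

lemma agree_below: "agree S t u \<Longrightarrow> below S t u"
  by (simp add: agree_def below_def)

text \<open>An implication is evaluated at the root by induction on its two sides, and above the
  root in matched worlds.\<close>

lemma agree_roots:
  assumes lab: "lab t \<inter> X = lab u \<inter> X"
    and forward: "\<And>w. w \<in> above t \<Longrightarrow> \<exists>v\<in>above u. agree (fms X k) w v"
    and backward: "\<And>v. v \<in> above u \<Longrightarrow> \<exists>w\<in>above t. agree (fms X k) w v"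
  shows "agree (fms X (Suc k)) t u"
proof -
  have "t \<tturnstile> B \<longleftrightarrow> u \<tturnstile> B" if "B \<in> fms X (Suc k)" for B
    using that
  proof (induction B)
    case (Atom x)
    then show ?case using lab by auto
  next
    case (Imp B C)
    then have BC: "B \<in> fms X k" "C \<in> fms X k" by auto
    then have "t \<tturnstile> B \<longleftrightarrow> u \<tturnstile> B" "t \<tturnstile> C \<longleftrightarrow> u \<tturnstile> C" using Imp.IH fms_Suc by blast+
    moreover have "(\<forall>s\<in>above t. s \<tturnstile> B \<longrightarrow> s \<tturnstile> C) \<longleftrightarrow> (\<forall>s\<in>above u. s \<tturnstile> B \<longrightarrow> s \<tturnstile> C)"
      using forward backward BC unfolding agree_def by metis
    ultimately show ?case by (simp add: up_eq)
  qed auto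
  then show ?thesis by (simp add: agree_def)
qed

text \<open>A one-sided gain of a level: to carry an implication from \<open>u\<close> to
  \<open>t\<close>, it is enough that every world over \<open>t\<close> has a partner over
  \<open>u\<close>, the two roots being matched with each other.\<close>

lemma below_roots:
  assumes "agree (fms X k) t u"
    and forward: "\<And>w. w \<in> above t \<Longrightarrow> \<exists>v\<in>above u. agree (fms X k) w v"
  shows "below (fms X (Suc k)) t u"
proof -
  have "u \<tturnstile> B \<longrightarrow> t \<tturnstile> B" if "B \<in> fms X (Suc k)" for B
    using that
  proof (induction B)
    case (Atom x)
    then have "Atom x \<in> fms X k" by simp
    then show ?case using assms(1) unfolding agree_def by blast
  next
    case (Imp B C)
    then have BC: "B \<in> fms X k" "C \<in> fms X k" by auto
    have "\<exists>v\<in>up u. agree (fms X k) w v" if "w \<in> up t" for w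
      using that assms by (auto simp: up_eq)
    then show ?case using BC unfolding agree_def forces.simps by metis
  qed auto
  then show ?thesis by (simp add: below_def)
qed

section \<open>The extension property\<close>

lemma below_represents: "represents R S \<Longrightarrow> below R t u \<longleftrightarrow> below S t u"
  unfolding represents_def below_def equiv_fm_def by (meson subsetD)

lemma agree_mono: "agree (fms X n) s t \<Longrightarrow> m \<le> n \<Longrightarrow> agree (fms X m) s t"
  using fms_mono unfolding agree_def by blast

text \<open>\<open>K\<close> may be infinite, but only finitely many sets of representatives occur
  as theories of its members. \<open>P\<close> is the disjunction of the conjunctions of these
  sets.\<close>

lemma finite_definable:
  assumes "finite X"
  shows "\<exists>P\<in>fms X (Suc n). \<forall>t. t \<tturnstile> P \<longleftrightarrow> (\<exists>u\<in>K. below (fms X (Suc n)) t u)"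
proof -
  obtain R where R: "represents R (fms X (Suc n))" using fms_represented[OF assms] by blast
  have "\<exists>C\<in>fms X (Suc n). \<forall>t. t \<tturnstile> C \<longleftrightarrow> (\<forall>B\<in>S. t \<tturnstile> B)" if "S \<subseteq> R" for S
    by (rule finite_conj) (use R that in \<open>auto simp: represents_def intro: finite_subset\<close>)
  then obtain c where c: "\<And>S. S \<subseteq> R \<Longrightarrow> c S \<in> fms X (Suc n)"
    "\<And>S t. S \<subseteq> R \<Longrightarrow> t \<tturnstile> c S \<longleftrightarrow> (\<forall>B\<in>S. t \<tturnstile> B)"
    by metis
  define th where "th = (\<lambda>u. {B \<in> R. u \<tturnstile> B})"
  have th: "th u \<subseteq> R" for u by (auto simp: th_def)
  have "th ` K \<subseteq> Pow R" using th by auto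
  then have "finite (th ` K)" using R by (auto simp: represents_def intro: finite_subset)
  then have "finite (c ` th ` K)" by simp
  moreover have "c ` th ` K \<subseteq> fms X (Suc n)" using c(1) th by auto
  ultimately obtain P where P: "P \<in> fms X (Suc n)"
    "\<forall>t. t \<tturnstile> P \<longleftrightarrow> (\<exists>B\<in>c ` th ` K. t \<tturnstile> B)"
    using finite_disj by (metis (lifting))
  have "t \<tturnstile> c (th u) \<longleftrightarrow> below (fms X (Suc n)) t u" for t u
    unfolding c(2)[OF th] below_represents[OF R, symmetric] by (auto simp: below_def th_def)
  then show ?thesis using P by auto
qed

text \<open>Ghilardi's extension property, relative to \<open>E\<close>. By persistence,
  \<open>P\<close> at the children gives \<open>P\<close> at all worlds above the root.\<close>

definition ext_prop :: "'a set \<Rightarrow> 'a fm \<Rightarrow> 'a fm \<Rightarrow> bool"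
  where "ext_prop var E P \<longleftrightarrow>
    (\<forall>L ts. pers (Node L ts) \<longrightarrow> Node L ts \<tturnstile> E \<longrightarrow> (\<forall>s\<in>set ts. s \<tturnstile> P) \<longrightarrow>
      (\<exists>L'. L' - var = L - var \<and> pers (Node L' ts) \<and> Node L' ts \<tturnstile> P))"

lemma agree_act:
  assumes "\<And>x. x \<in> Y \<Longrightarrow> g x = Atom x"
  shows "agree (fms Y k) (act g t) t"
proof -
  have "act g t \<tturnstile> B \<longleftrightarrow> t \<tturnstile> B" if "B \<in> fms Y k" for B
    using that assms subst_id[of B Y g] by (simp add: fms_def forces_subst[symmetric])
  then show ?thesis by (simp add: agree_def)
qed

lemma above_act: "above (act g t) = act g ` above t"
  by (cases t) (auto simp: up_act)

text \<open>The worlds above the root agree up to depth \<open>n - 1\<close> with worlds of \<open>K\<close>, so gluing these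
  worlds of \<open>K\<close> below a common root yields a model that differs from the given one, up to
  depth \<open>n\<close>, only in the variables at the root. The depth of \<open>E\<close> is below \<open>n\<close>, which makes \<open>E\<close>
  true in the glued model.\<close>

lemma ext_prop_image:
  fixes var par :: "'a set" and E P :: "'a fm" and g :: "'a \<Rightarrow> 'a fm" and m :: nat
  defines "X \<equiv> var \<union> par" and "K \<equiv> act g ` {N. pers N \<and> N \<tturnstile> E}"
  assumes fin: "finite X" and disj: "var \<inter> par = {}" and g: "\<And>x. x \<in> par \<Longrightarrow> g x = Atom x"
    and E: "E \<in> fms par (Suc (Suc m))"
    and P: "\<And>t. t \<tturnstile> P \<longleftrightarrow> (\<exists>u\<in>K. below (fms X (Suc (Suc (Suc m)))) t u)"
  shows "ext_prop var E P"
  unfolding ext_prop_def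
proof (intro allI impI)
  fix L :: "'a set" and ts
  define M where "M = Node L ts"
  assume "pers (Node L ts)" "Node L ts \<tturnstile> E" and kids: "\<forall>s\<in>set ts. s \<tturnstile> P"
  then have M: "pers M" "M \<tturnstile> E" by (simp_all add: M_def)
  \<comment> \<open>\<open>w\<close> forces \<open>P\<close>, so it lies below some image
    \<open>act g N\<close>. \<open>below_forward\<close> at \<open>w\<close> itself finds an
    agreeing world of that image, which is again the image of a world of \<open>N\<close>.\<close>
  have "\<exists>N. pers N \<and> N \<tturnstile> E \<and> agree (fms X (Suc (Suc m))) w (act g N)" if w: "w \<in> above M" for w
  proof -
    obtain s where s: "s \<in> set ts" "w \<in> up s" using w by (auto simp: M_def)
    then have "w \<tturnstile> P" using forces_up[of s P w] kids M(1) by (auto simp: M_def)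
    then obtain N where N: "pers N" "N \<tturnstile> E" "below (fms X (Suc (Suc (Suc m)))) w (act g N)"
      using P by (auto simp: K_def)
    obtain v where "v \<in> up (act g N)" "agree (fms X (Suc (Suc m))) w v"
      using below_forward[OF fin N(3) up_refl] by blast
    then show ?thesis using N(1,2) pers_up forces_up unfolding up_act by blast
  qed
  then obtain V where V: "\<And>w. w \<in> above M \<Longrightarrow> pers (V w)" "\<And>w. w \<in> above M \<Longrightarrow> V w \<tturnstile> E"
    "\<And>w. w \<in> above M \<Longrightarrow> agree (fms X (Suc (Suc m))) w (act g (V w))"
    by metis
  obtain ss where ss: "set ss = V ` above M" using finite_list[of "V ` above M"] by auto
  \<comment> \<open>The root keeps the parameters of \<open>L\<close>; its variables are revalued
    when \<open>act g\<close> is applied to \<open>N0\<close>.\<close>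
  define N0 where "N0 = Node (L \<inter> par) ss"
  have aboveN0: "above N0 = (\<Union>w\<in>above M. up (V w))" by (simp add: N0_def ss)
  have V_above: "V w \<in> above N0" if "w \<in> above M" for w
    unfolding aboveN0 using that up_refl by (rule UN_I)
  have lab_V: "x \<in> lab (act g (V w)) \<longleftrightarrow> x \<in> lab w" if "w \<in> above M" "x \<in> X" for w x
  proof -
    have "w \<tturnstile> Atom x \<longleftrightarrow> act g (V w) \<tturnstile> Atom x"
      using V(3)[OF that(1)] that(2) unfolding agree_def by (meson fms_simps(1))
    then show ?thesis by (simp only: forces.simps)
  qed
  have lab_M: "L \<subseteq> lab w" if "w \<in> above M" for w
    using pers_up[OF M(1) above_up[OF that]] by (simp add: M_def)
  have "pers N0"
    unfolding N0_def pers.simps ss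
  proof (intro ballI conjI subsetI)
    fix s x assume "s \<in> V ` above M" "x \<in> L \<inter> par"
    then obtain w where w: "w \<in> above M" "s = V w" "x \<in> L" "x \<in> par" by auto
    then have "x \<in> lab (act g (V w))" using lab_M[OF w(1)] lab_V[OF w(1)] by (auto simp: X_def)
    then show "x \<in> lab s" using w g by simp
  next
    fix s assume "s \<in> V ` above M"
    then show "pers s" using V(1) by auto
  qed
  \<comment> \<open>A world of \<open>N0\<close> may lie properly above the chosen
    \<open>V w\<close>; finding its partner costs one more level of depth.\<close>
  have backward: "\<exists>w\<in>above M. agree (fms X (Suc m)) w (act g v)" if "v \<in> above N0" for v
  proof -
    obtain w where w: "w \<in> above M" "v \<in> up (V w)" using \<open>v \<in> above N0\<close> aboveN0 by auto
    have "below (fms X (Suc (Suc m))) (act g (V w)) w"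
      using V(3)[OF w(1)] agree_sym agree_below by blast
    moreover have "act g v \<in> up (act g (V w))" using w(2) by (simp add: up_act)
    ultimately obtain u where "u \<in> up w" "agree (fms X (Suc m)) (act g v) u"
      using below_forward[OF fin] by blast
    then show ?thesis using above_trans[OF w(1)] agree_sym by blast
  qed
  have par: "agree (fms par k) w v" if "agree (fms X k) w (act g v)" for w v k
  proof -
    have "fms par k \<subseteq> fms X k" by (auto simp: fms_def lang_def X_def)
    then have "agree (fms par k) w (act g v)" using that by (auto simp: agree_def)
    then show ?thesis using agree_act[OF g] agree_trans by blast
  qed
  have "agree (fms par (Suc (Suc m))) M N0"
  proof (rule agree_roots)
    show "lab M \<inter> par = lab N0 \<inter> par" by (auto simp: M_def N0_def)
    show "\<exists>v\<in>above N0. agree (fms par (Suc m)) w v" if "w \<in> above M" for w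
      using V(3)[OF that] V_above[OF that] par agree_mono[of X "Suc (Suc m)" _ _ "Suc m"]
      by (meson lessI less_imp_le)
    show "\<exists>w\<in>above M. agree (fms par (Suc m)) w v" if "v \<in> above N0" for v
      using backward[OF that] par by blast
  qed
  then have "N0 \<tturnstile> E" using E M(2) by (auto simp: agree_def)
  define N where "N = act g N0"
  have "N \<in> K" using \<open>pers N0\<close> \<open>N0 \<tturnstile> E\<close> by (auto simp: K_def N_def)
  have aboveN: "above N = act g ` above N0" by (simp add: N_def above_act)
  define L' where "L' = (lab N \<inter> var) \<union> (L - var)"
  define M' where "M' = Node L' ts"
  have aboveM': "above M' = above M" by (simp add: M'_def M_def)
  have "pers N" using \<open>pers N0\<close> pers_act by (simp add: N_def)
  have "lab N \<inter> var \<subseteq> lab w" if "w \<in> above M" for w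
  proof -
    have "act g (V w) \<in> up N"
      using V_above[OF that] aboveN by (auto intro: above_up)
    then have "lab N \<subseteq> lab (act g (V w))" using pers_up \<open>pers N\<close> by blast
    then show ?thesis using lab_V[OF that] by (auto simp: X_def)
  qed
  then have "\<forall>w\<in>above M. L' \<subseteq> lab w" using lab_M by (auto simp: L'_def)
  moreover have "\<forall>t\<in>set ts. pers t" using M(1) by (simp add: M_def)
  ultimately have "pers M'" using aboveM'
    unfolding M'_def pers_iff by (simp del: above_Node)
  have forward: "\<exists>v\<in>above N. agree (fms X (Suc (Suc m))) w v" if "w \<in> above M'" for w
    using V(3) V_above that unfolding aboveM' aboveN by blast
  have "agree (fms X (Suc (Suc m))) M' N"
  proof (rule agree_roots)
    have "x \<in> lab N \<longleftrightarrow> x \<in> L" if "x \<in> par" for x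
      using that g by (simp add: N_def N0_def)
    then show "lab M' \<inter> X = lab N \<inter> X" using disj by (auto simp: M'_def L'_def X_def)
    show "\<exists>v\<in>above N. agree (fms X (Suc m)) w v" if "w \<in> above M'" for w
      using forward[OF that] agree_mono[of X "Suc (Suc m)" _ _ "Suc m"] by (meson lessI less_imp_le)
    show "\<exists>w\<in>above M'. agree (fms X (Suc m)) w v" if "v \<in> above N" for v
      using that backward unfolding aboveM' aboveN by blast
  qed
  \<comment> \<open>Forward matching has kept depth \<open>m + 2\<close>, so the one-sided
    comparison reaches \<open>m + 3\<close>, the depth at which \<open>P\<close> is defined.\<close>
  then have "below (fms X (Suc (Suc (Suc m)))) M' N" using below_roots forward by blast
  then have "M' \<tturnstile> P" using P \<open>N \<in> K\<close> by blast
  then show "\<exists>L'. L' - var = L - var \<and> pers (Node L' ts) \<and> Node L' ts \<tturnstile> P"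
    using \<open>pers M'\<close> unfolding M'_def by (intro exI[of _ L']) (auto simp: L'_def)
qed

text \<open>\<open>P\<close> defines the image of \<open>g\<close>. \<open>A\<close> holds on the
  image and its depth is within the bound, so it passes to every tree forcing
  \<open>P\<close>.\<close>

lemma ext_prop_below_unifier:
  fixes var par :: "'a set" and A E :: "'a fm" and g :: "'a \<Rightarrow> 'a fm" and m :: nat
  defines "X \<equiv> var \<union> par"
  assumes fin: "finite X" and disj: "var \<inter> par = {}" and g: "\<And>x. x \<in> par \<Longrightarrow> g x = Atom x"
    and E: "E \<in> fms par (Suc (Suc m))" and A: "A \<in> fms X (Suc (Suc (Suc m)))"
    and unif: "\<And>t. pers t \<Longrightarrow> t \<tturnstile> E \<Longrightarrow> t \<tturnstile> subst g A"
  shows "\<exists>P\<in>fms X (Suc (Suc (Suc m))). ext_prop var E P \<and> (\<forall>t. t \<tturnstile> P \<longrightarrow> t \<tturnstile> A) \<and>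
    (\<forall>t. pers t \<longrightarrow> t \<tturnstile> E \<longrightarrow> t \<tturnstile> subst g P)"
proof -
  define K where "K = act g ` {N. pers N \<and> N \<tturnstile> E}"
  obtain P where P: "P \<in> fms X (Suc (Suc (Suc m)))"
    "\<forall>t. t \<tturnstile> P \<longleftrightarrow> (\<exists>u\<in>K. below (fms X (Suc (Suc (Suc m)))) t u)"
    using finite_definable[OF fin, of "Suc (Suc m)" K] by (elim bexE)
  have "ext_prop var E P"
    using ext_prop_image[OF fin[unfolded X_def] disj g E, of P] P(2) by (simp add: K_def X_def)
  moreover have "t \<tturnstile> A" if "t \<tturnstile> P" for t
  proof -
    obtain N where "pers N" "N \<tturnstile> E" "below (fms X (Suc (Suc (Suc m)))) t (act g N)"
      using P(2) \<open>t \<tturnstile> P\<close> by (auto simp: K_def)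
    moreover from this have "act g N \<tturnstile> A" using unif by (simp add: forces_subst)
    ultimately show ?thesis using A by (auto simp: below_def)
  qed
  moreover have "t \<tturnstile> subst g P" if "pers t" "t \<tturnstile> E" for t
  proof -
    have "act g t \<in> K" using that by (auto simp: K_def)
    moreover have "below (fms X (Suc (Suc (Suc m)))) (act g t) (act g t)" by (simp add: below_def)
    ultimately show ?thesis using P(2) by (auto simp: forces_subst)
  qed
  ultimately show ?thesis using P(1) by blast
qed

section \<open>Extensible formulas are projective\<close>

definition theta :: "'a set \<Rightarrow> 'a fm \<Rightarrow> 'a set \<Rightarrow> 'a \<Rightarrow> 'a fm"
  where "theta var P a x =
    (if x \<in> var then if x \<in> a then P \<^bold>\<longrightarrow> Atom x else P \<^bold>\<and> Atom x else Atom x)"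

definition acts :: "'a set \<Rightarrow> 'a fm \<Rightarrow> 'a set list \<Rightarrow> 'a ktree \<Rightarrow> 'a ktree"
  where "acts var P = fold (\<lambda>a. act (theta var P a))"

lemma acts_Nil [simp]: "acts var P [] t = t"
  by (simp add: acts_def)

lemma acts_Cons: "acts var P (a # as) t = acts var P as (act (theta var P a) t)"
  by (simp add: acts_def)

lemma acts_append: "acts var P (as @ bs) t = acts var P bs (acts var P as t)"
  by (simp add: acts_def)

lemma acts_snoc: "acts var P (as @ [a]) t = act (theta var P a) (acts var P as t)"
  by (simp add: acts_append acts_Cons)

text \<open>By persistence \<open>P\<close> holds in the whole tree, and there both values that
  \<open>theta\<close> offers for \<open>x\<close> have the truth value of \<open>x\<close>.\<close>

lemma act_theta_fixed: "pers t \<Longrightarrow> t \<tturnstile> P \<Longrightarrow> act (theta var P a) t = t"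
proof (induction t)
  case (Node L ts)
  have "act (theta var P a) s = s" if "s \<in> set ts" for s
  proof -
    have "s \<in> up (Node L ts)" using UN_I[OF that up_refl] unfolding up.simps by (rule insertI2)
    then show ?thesis using Node that forces_up pers_up by blast
  qed
  then have "map (act (theta var P a)) ts = ts" by (simp add: map_idI)
  moreover have "Node L ts \<tturnstile> theta var P a x \<longleftrightarrow> x \<in> L" for x
  proof -
    have "Node L ts \<tturnstile> P \<^bold>\<longrightarrow> Atom x \<longleftrightarrow> x \<in> L"
      using Node.prems pers_up[OF Node.prems(1)] up_refl[of "Node L ts"] ktree.sel(1)[of L ts]
      unfolding forces.simps by blast
    then show ?thesis using Node.prems(2) by (simp add: theta_def del: forces.simps(5))
  qed
  ultimately show ?case by simp
qed

lemma acts_fixed: "pers t \<Longrightarrow> t \<tturnstile> P \<Longrightarrow> acts var P as t = t"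
  by (induction as) (simp_all add: acts_Cons act_theta_fixed)

lemma pers_acts: "pers t \<Longrightarrow> pers (acts var P as t)"
  by (induction as arbitrary: t) (simp_all add: acts_Cons pers_act)

lemma up_acts: "up (acts var P as t) = acts var P as ` up t"
  by (induction as arbitrary: t) (simp_all add: acts_Cons up_act image_image)

lemma lab_acts: "x \<notin> var \<Longrightarrow> x \<in> lab (acts var P as t) \<longleftrightarrow> x \<in> lab t"
  by (induction as arbitrary: t) (simp_all add: acts_Cons theta_def)

lemma kids_acts: "kids (acts var P as t) = map (acts var P as) (kids t)"
proof (induction as arbitrary: t)
  case Nil
  then show ?case by (simp add: acts_def)
next
  case (Cons a as)
  then show ?case by (cases t) (simp add: acts_Cons)
qed

lemma act_Atom [simp]: "act Atom t = t"
  by (induction t) (auto intro: map_idI)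

lemma acts_subst:
  assumes "P \<in> lang X" "var \<subseteq> X"
  shows "\<exists>f. (\<forall>x. x \<notin> var \<longrightarrow> f x = Atom x) \<and> (\<forall>x\<in>X. f x \<in> lang X) \<and> (\<forall>t. acts var P as t = act f t)"
proof (induction as)
  case Nil
  show ?case by (intro exI[of _ Atom]) (simp add: lang_def)
next
  case (Cons a as)
  then obtain f where f: "\<And>x. x \<notin> var \<Longrightarrow> f x = Atom x" "\<And>x. x \<in> X \<Longrightarrow> f x \<in> lang X"
    "\<And>t. acts var P as t = act f t"
    by blast
  have "theta var P a x \<in> lang X" if "x \<in> X" for x
    using that assms by (auto simp: theta_def lang_def)
  then have "subst (theta var P a) (f x) \<in> lang X" if "x \<in> X" for x
    using f(2)[OF that] subst_lang by blast
  moreover have "subst (theta var P a) (f x) = Atom x" if "x \<notin> var" for x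
    using f(1)[OF that] that by (simp add: theta_def)
  ultimately show ?case
    by (intro exI[of _ "\<lambda>x. subst (theta var P a) (f x)"]) (simp add: acts_Cons f(3) act_act)
qed

text \<open>With \<open>R\<close> representing the formulas of depth at most \<open>k\<close>, these
  are the depth-\<open>k\<close> types of the worlds over \<open>t\<close> that force
  \<open>P\<close>. In a persistent tree every \<open>act (theta var P a)\<close> fixes such
  worlds.\<close>

definition ptypes :: "'a fm set \<Rightarrow> 'a fm \<Rightarrow> 'a ktree \<Rightarrow> 'a fm set set"
  where "ptypes R P t = (\<lambda>u. {B \<in> R. u \<tturnstile> B}) ` {u \<in> up t. u \<tturnstile> P}"

lemma ptypes_up: "s \<in> up t \<Longrightarrow> ptypes R P s \<subseteq> ptypes R P t"
  using up_trans by (fastforce simp: ptypes_def)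

lemma finite_ptypes [simp]: "finite (ptypes R P t)"
  by (simp add: ptypes_def)

text \<open>Worlds forcing \<open>P\<close> are fixed and so survive in the image; types can only be
  added.\<close>

lemma ptypes_acts:
  assumes "pers t"
  shows "ptypes R P t \<subseteq> ptypes R P (acts var P as t)"
proof -
  have "{u \<in> up t. u \<tturnstile> P} \<subseteq> {u \<in> up (acts var P as t). u \<tturnstile> P}"
  proof
    fix u assume u: "u \<in> {u \<in> up t. u \<tturnstile> P}"
    then have "acts var P as u = u" using acts_fixed pers_up[OF assms] by blast
    then have "u \<in> acts var P as ` up t" using u by (metis (lifting) image_eqI mem_Collect_eq)
    then show "u \<in> {u \<in> up (acts var P as t). u \<tturnstile> P}" using u by (simp add: up_acts)
  qed
  then show ?thesis unfolding ptypes_def by (rule image_mono)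
qed

lemma ptypes_eqD:
  assumes "represents R S" "ptypes R P t = ptypes R P u" "w \<in> up t" "w \<tturnstile> P"
  shows "\<exists>v\<in>up u. v \<tturnstile> P \<and> agree S w v"
proof -
  have "{B \<in> R. w \<tturnstile> B} \<in> ptypes R P t"
    using imageI[of w "{u \<in> up t. u \<tturnstile> P}" "\<lambda>u. {B \<in> R. u \<tturnstile> B}"] assms(3,4)
    by (simp add: ptypes_def)
  then have "{B \<in> R. w \<tturnstile> B} \<in> ptypes R P u" using assms(2) by simp
  then obtain v where v: "v \<in> up u" "v \<tturnstile> P" "{B \<in> R. w \<tturnstile> B} = {B \<in> R. v \<tturnstile> B}"
    by (auto simp: ptypes_def)
  then have "agree R w v" by (auto simp: agree_def)
  then show ?thesis using v agree_represents[OF assms(1)] by blast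
qed

text \<open>Climb as long as some child refutes \<open>P\<close>. The world reached is the one to
  which the extension property gets applied.\<close>

lemma frontier: "\<not> t \<tturnstile> P \<Longrightarrow> \<exists>f\<in>up t. \<not> f \<tturnstile> P \<and> (\<forall>s\<in>set (kids f). s \<tturnstile> P)"
proof (induction t)
  case (Node L ts)
  show ?case
  proof (cases "\<forall>s\<in>set ts. s \<tturnstile> P")
    case True
    then show ?thesis using Node.prems by (intro bexI[of _ "Node L ts"]) auto
  next
    case False
    then obtain s where "s \<in> set ts" "\<not> s \<tturnstile> P" by blast
    then show ?thesis using Node.IH[of s] by auto
  qed
qed

text \<open>The two sides of an implication of depth at most \<open>k + 1\<close> have depth at most
  \<open>k\<close>; this is why depth-\<open>k\<close> types suffice in
  \<open>uniform_step\<close>.\<close>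

locale extensible =
  fixes var par :: "'a set" and E P :: "'a fm" and k :: nat and R :: "'a fm set"
  assumes fin: "finite (var \<union> par)"
    and disj: "var \<inter> par = {}"
    and E: "E \<in> lang par"
    and P: "P \<in> fms (var \<union> par) (Suc k)"
    and R: "represents R (fms (var \<union> par) k)"
    and ext: "ext_prop var E P"
begin

abbreviation "run \<equiv> acts var P"

abbreviation "types \<equiv> ptypes R P"

lemma run_E: "run as t \<tturnstile> E \<longleftrightarrow> t \<tturnstile> E"
proof (induction as arbitrary: t)
  case (Cons a as)
  have "subst (theta var P a) E = E"
    by (rule subst_id[OF E]) (use disj in \<open>auto simp: theta_def\<close>)
  then show ?case using Cons by (simp add: acts_Cons forces_subst[symmetric])
qed simp

text \<open>Meant for the worlds refuting \<open>P\<close> over a point from which on neither their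
  parameters nor their \<open>types\<close> change; no sequence of steps separates them with respect
  to \<open>P\<close>, by \<open>uniform_all_or_none\<close>.\<close>

definition uniform :: "'a ktree set \<Rightarrow> bool"
  where "uniform U \<longleftrightarrow> (\<forall>u\<in>U. pers u \<and> \<not> u \<tturnstile> P \<and> (\<forall>s\<in>up u. s \<tturnstile> P \<or> s \<in> U)) \<and>
    (\<forall>u\<in>U. \<forall>v\<in>U. types u = types v \<and> lab u \<inter> par = lab v \<inter> par)"

text \<open>After one more step the points of \<open>U\<close> carry the same label, because a variable survives at
  such a point iff it was selected and holds at all points above that force \<open>P\<close>.\<close>

lemma uniform_step:
  assumes U: "uniform U" and none: "\<forall>u\<in>U. \<not> run bs u \<tturnstile> P" and "u \<in> U" "v \<in> U"
  shows "agree (fms (var \<union> par) (Suc k)) (run (bs @ [a]) u) (run (bs @ [a]) v)"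
proof -
  have U_fixed: "run cs s = s" if "u \<in> U" "s \<in> up u" "s \<tturnstile> P" for u s cs
    using acts_fixed[of s] that U pers_up unfolding uniform_def by blast
  have U_cases: "s \<tturnstile> P \<or> s \<in> U" if "u \<in> U" "s \<in> up u" for u s
    using U that unfolding uniform_def by blast
  have types: "\<exists>s'\<in>up v. s' \<tturnstile> P \<and> agree (fms (var \<union> par) k) s s'"
    if "u \<in> U" "v \<in> U" "s \<in> up u" "s \<tturnstile> P" for u v s
    using U that ptypes_eqD[OF R, of P u v s] unfolding uniform_def by blast
  \<comment> \<open>After \<open>bs\<close> all worlds of \<open>U\<close> still refute
    \<open>P\<close>, so the implication only concerns the worlds that forced \<open>P\<close> from
    the start, and these are unchanged.\<close>
  have imp: "run bs u \<tturnstile> P \<^bold>\<longrightarrow> Atom x \<longleftrightarrow> (\<forall>s\<in>up u. s \<tturnstile> P \<longrightarrow> x \<in> lab s)" if "u \<in> U" for u x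
  proof -
    have "(run bs s \<tturnstile> P \<longrightarrow> x \<in> lab (run bs s)) \<longleftrightarrow> (s \<tturnstile> P \<longrightarrow> x \<in> lab s)" if "s \<in> up u" for s
      using U_cases[OF \<open>u \<in> U\<close> that] U_fixed[OF \<open>u \<in> U\<close> that] none U unfolding uniform_def
      by (cases "s \<tturnstile> P") auto
    then show ?thesis by (simp add: up_acts)
  qed
  have "run (bs @ [a]) u \<tturnstile> B \<Longrightarrow> run (bs @ [a]) v \<tturnstile> B"
    if "B \<in> fms (var \<union> par) (Suc k)" "u \<in> U" "v \<in> U" for B u v
    using that
  proof (induction B arbitrary: u v)
    case (Atom x)
    show ?case
    proof (cases "x \<in> var")
      case False
      then have "x \<in> par" using Atom by auto
      then have "x \<in> lab u \<longleftrightarrow> x \<in> lab v" using U Atom.prems unfolding uniform_def by blast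
      then show ?thesis using Atom lab_acts[OF False] by simp
    next
      case True
      have "run bs u \<tturnstile> theta var P a x" using Atom.prems(1) by (simp add: acts_snoc)
      then have "x \<in> a" "run bs u \<tturnstile> P \<^bold>\<longrightarrow> Atom x"
        using none Atom.prems(3) True by (auto simp: theta_def split: if_splits)
      then have *: "\<forall>s\<in>up u. s \<tturnstile> P \<longrightarrow> x \<in> lab s" using imp[OF Atom.prems(3)] by simp
      have "x \<in> lab s" if s: "s \<in> up v" "s \<tturnstile> P" for s
      proof -
        obtain s' where "s' \<in> up u" "s' \<tturnstile> P" "agree (fms (var \<union> par) k) s s'"
          using types[OF Atom.prems(4,3) s] by blast
        moreover have "Atom x \<in> fms (var \<union> par) k" using True by simp
        ultimately show ?thesis using * unfolding agree_def by (metis forces.simps(1))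
      qed
      then have "run bs v \<tturnstile> P \<^bold>\<longrightarrow> Atom x" using imp[OF Atom.prems(4)] by simp
      then show ?thesis using \<open>x \<in> a\<close> True by (simp add: acts_snoc theta_def)
    qed
  next
    case (Or B C)
    then show ?case by auto
  next
    case (And B C)
    then show ?case by auto
  next
    case (Imp B C)
    then have BC: "B \<in> fms (var \<union> par) k" "C \<in> fms (var \<union> par) k" by auto
    show ?case
      unfolding forces.simps up_acts
    proof (intro ballI impI)
      fix r assume "r \<in> run (bs @ [a]) ` up v" and rB: "r \<tturnstile> B"
      then obtain s where s: "s \<in> up v" "r = run (bs @ [a]) s" by auto
      \<comment> \<open>If \<open>s\<close> lies in \<open>U\<close>, its partner is
        \<open>u\<close> itself and the induction hypotheses pass between the two; otherwise
        \<open>s\<close> forces \<open>P\<close>, is fixed, and has a partner over \<open>u\<close>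
        agreeing up to depth \<open>k\<close>.\<close>
      show "r \<tturnstile> C"
      proof (cases "s \<in> U")
        case True
        have "run (bs @ [a]) u \<tturnstile> B"
          using Imp.IH(1)[OF _ fms_Suc[OF BC(1)] True Imp.prems(3)] rB s(2) by simp
        then have "run (bs @ [a]) u \<tturnstile> C" using Imp.prems(1) by simp
        then show ?thesis using Imp.IH(2)[OF _ fms_Suc[OF BC(2)] Imp.prems(3) True] s(2) by simp
      next
        case False
        then have "s \<tturnstile> P" using U_cases[OF Imp.prems(4) s(1)] by blast
        then have "r = s" using U_fixed[OF Imp.prems(4) s(1)] s(2) by simp
        obtain s' where s': "s' \<in> up u" "s' \<tturnstile> P" "agree (fms (var \<union> par) k) s s'"
          using types[OF Imp.prems(4,3) s(1) \<open>s \<tturnstile> P\<close>] by blast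
        have "run (bs @ [a]) s' = s'" using U_fixed[OF Imp.prems(3) s'(1,2)] .
        then have "s' \<in> up (run (bs @ [a]) u)" unfolding up_acts using s'(1) by (metis image_eqI)
        moreover have "s' \<tturnstile> B" using s'(3) BC(1) rB \<open>r = s\<close> by (simp add: agree_def)
        ultimately have "s' \<tturnstile> C" using Imp.prems(1) by simp
        then show ?thesis using s'(3) BC(2) \<open>r = s\<close> by (simp add: agree_def)
      qed
    qed
  qed simp
  then show ?thesis using assms(3,4) unfolding agree_def by blast
qed

text \<open>Worlds that force \<open>P\<close> no longer change; while all of them refute it,
  \<open>uniform_step\<close> makes them agree after the next step at the depth of
  \<open>P\<close>.\<close>

lemma uniform_all_or_none:
  assumes U: "uniform U"
  shows "(\<forall>u\<in>U. run bs u \<tturnstile> P) \<or> (\<forall>u\<in>U. \<not> run bs u \<tturnstile> P)"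
proof (induction bs rule: rev_induct)
  case Nil
  show ?case using U by (auto simp: uniform_def)
next
  case (snoc a bs)
  show ?case
  proof (cases "\<forall>u\<in>U. run bs u \<tturnstile> P")
    case True
    have "run (bs @ [a]) u = run bs u" if "u \<in> U" for u
      unfolding acts_snoc by (rule act_theta_fixed) (use True that U in \<open>auto simp: uniform_def pers_acts\<close>)
    then show ?thesis using True by simp
  next
    case False
    then have "\<forall>u\<in>U. \<not> run bs u \<tturnstile> P" using snoc.IH by blast
    then show ?thesis using uniform_step[OF U, of bs] P unfolding agree_def by metis
  qed
qed

text \<open>Some set in \<open>as\<close> repairs a frontier world as the extension property
  prescribes. Then \<open>P\<close> holds at all worlds of the uniform set, among them
  \<open>w\<close>, and the rest of the round preserves it.\<close>

lemma uniform_round: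
  assumes w: "pers w" "w \<tturnstile> E" and U: "uniform {u \<in> up w. \<not> u \<tturnstile> P}"
    and as: "\<And>a. a \<subseteq> var \<Longrightarrow> a \<in> set as"
  shows "run as w \<tturnstile> P"
proof (cases "w \<tturnstile> P")
  case True
  then show ?thesis using acts_fixed[OF w(1)] by simp
next
  case False
  let ?U = "{u \<in> up w. \<not> u \<tturnstile> P}"
  obtain f where f: "f \<in> up w" "\<not> f \<tturnstile> P" "\<forall>s\<in>set (kids f). s \<tturnstile> P"
    using frontier[OF False] by blast
  obtain L ts where Lts: "f = Node L ts" by (cases f)
  have "pers f" "f \<tturnstile> E" using f(1) w pers_up forces_up by blast+
  then obtain L' where L': "L' - var = L - var" "pers (Node L' ts)" "Node L' ts \<tturnstile> P"
    using ext f(3) unfolding ext_prop_def Lts ktree.sel by (elim allE impE) blast+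
  define a where "a = L' \<inter> var"
  obtain bs cs where split: "as = (bs @ [a]) @ cs"
    using as[of a] split_list[of a as] by (auto simp: a_def)
  have "run (bs @ [a]) w \<tturnstile> P"
  proof (cases "\<forall>u\<in>?U. run bs u \<tturnstile> P")
    case True
    then have "run bs w \<tturnstile> P" using False by simp
    then show ?thesis using act_theta_fixed[OF pers_acts[OF w(1)]] by (simp add: acts_snoc)
  next
    case none: False
    then have "\<not> run bs f \<tturnstile> P" using uniform_all_or_none[OF U, of bs] f by blast
    define L1 where "L1 = lab (run bs f)"
    have kids: "map (run cs) ts = ts" for cs
      by (rule map_idI) (use f(3) \<open>pers f\<close> in \<open>auto simp: Lts intro: acts_fixed\<close>)
    have "kids (run bs f) = ts" unfolding kids_acts Lts by (simp add: kids)
    then have f1: "run bs f = Node L1 ts" unfolding L1_def by (cases "run bs f") auto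
    have above: "a \<subseteq> lab s" if "s \<in> above (Node L1 ts)" for s
      using L'(2) that unfolding pers_iff above_Node a_def by blast
    \<comment> \<open>\<open>P\<close> fails at this root. Hence a variable in \<open>a\<close>,
      being true at all worlds above, becomes true, and every other variable becomes false.\<close>
    have "Node L1 ts \<tturnstile> theta var P a x \<longleftrightarrow> x \<in> L'" for x
    proof (cases "x \<in> var")
      case True
      have "Node L1 ts \<tturnstile> P \<^bold>\<longrightarrow> Atom x" if "x \<in> a"
        using that above \<open>\<not> run bs f \<tturnstile> P\<close> unfolding f1 forces.simps up_eq by blast
      then show ?thesis
        using True \<open>\<not> run bs f \<tturnstile> P\<close> unfolding f1 by (auto simp: theta_def a_def)
    next
      case False
      then have "x \<in> L1 \<longleftrightarrow> x \<in> L" using lab_acts[OF False, of P bs f] by (simp add: L1_def Lts)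
      then show ?thesis using False L'(1) by (auto simp: theta_def)
    qed
    moreover have "map (act (theta var P a)) ts = ts" using kids[of "[a]"] by (simp add: acts_def)
    ultimately have "run (bs @ [a]) f = Node L' ts" unfolding acts_snoc f1 by simp
    then have "\<forall>u\<in>?U. run (bs @ [a]) u \<tturnstile> P"
      using uniform_all_or_none[OF U, of "bs @ [a]"] f L'(3) by auto
    then show ?thesis using False by simp
  qed
  then show ?thesis
    unfolding split acts_append[of _ _ "bs @ [a]"] using acts_fixed[OF pers_acts[OF w(1)]] by simp
qed

text \<open>A round makes the potential grow at every point not forcing \<open>P\<close>: if it did not grow at \<open>w\<close>,
  then the points above \<open>w\<close> not forcing \<open>P\<close> would form a uniform set, and the round would force \<open>P\<close> there.\<close>

definition potential :: "'a ktree \<Rightarrow> nat"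
  where "potential t = card (par - lab t) + card (types t)"

lemma potential_round:
  assumes t: "pers t" "t \<tturnstile> E" and r: "\<forall>u\<in>up t. \<not> u \<tturnstile> P \<longrightarrow> r \<le> potential u"
    and as: "\<And>a. a \<subseteq> var \<Longrightarrow> a \<in> set as"
  shows "\<forall>u\<in>up (run as t). \<not> u \<tturnstile> P \<longrightarrow> Suc r \<le> potential u"
proof (intro ballI impI, rule ccontr)
  fix u' assume "u' \<in> up (run as t)" and u': "\<not> u' \<tturnstile> P" "\<not> Suc r \<le> potential u'"
  then obtain w where w: "w \<in> up t" "u' = run as w" by (auto simp: up_acts)
  have "pers w" "w \<tturnstile> E" using w(1) t pers_up forces_up by blast+
  have fin_par: "finite (par - L)" for L using fin by simp
  have "x \<in> lab u' \<longleftrightarrow> x \<in> lab w" if "x \<in> par" for x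
    using lab_acts[of x var P as w] disj that w(2) by auto
  then have "par - lab u' = par - lab w" by auto
  moreover have "card (types w) \<le> card (types u')"
    unfolding w(2) by (intro card_mono finite_ptypes ptypes_acts \<open>pers w\<close>)
  ultimately have "potential w \<le> r" using u'(2) by (simp add: potential_def)
  \<comment> \<open>Both summands of the potential can only decrease from \<open>w\<close> to
    \<open>u\<close>, while \<open>potential w \<le> r \<le> potential u\<close>; so neither
    changes.\<close>
  have eq: "types u = types w \<and> lab u \<inter> par = lab w \<inter> par" if "u \<in> up w" "\<not> u \<tturnstile> P" for u
  proof -
    have "r \<le> potential u" using r up_trans[OF w(1) that(1)] that(2) by blast
    moreover have sub: "types u \<subseteq> types w" "par - lab u \<subseteq> par - lab w"
      using ptypes_up[OF that(1)] pers_up[OF \<open>pers w\<close> that(1)] by auto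
    moreover have "card (types u) \<le> card (types w)" "card (par - lab u) \<le> card (par - lab w)"
      using sub fin_par by (auto intro: card_mono)
    ultimately have "card (types u) = card (types w)" "card (par - lab u) = card (par - lab w)"
      using \<open>potential w \<le> r\<close> by (auto simp: potential_def)
    then have "types u = types w" "par - lab u = par - lab w"
      using card_subset_eq[OF finite_ptypes sub(1)] card_subset_eq[OF fin_par sub(2)] by simp_all
    then show ?thesis by blast
  qed
  have "uniform {u \<in> up w. \<not> u \<tturnstile> P}"
    unfolding uniform_def using eq pers_up[OF \<open>pers w\<close>] up_trans[of _ w] by auto
  then have "run as w \<tturnstile> P" using uniform_round[OF \<open>pers w\<close> \<open>w \<tturnstile> E\<close> _ as] by blast
  then show False using u'(1) w(2) by simp
qed

lemma potential_bound: "potential t \<le> card par + 2 ^ card R"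
proof -
  have R_fin: "finite R" using R by (simp add: represents_def)
  have "card (types t) \<le> card (Pow R)"
    by (rule card_mono) (use R_fin in \<open>auto simp: ptypes_def\<close>)
  moreover have "card (par - lab t) \<le> card par" using fin by (auto intro: card_mono)
  ultimately show ?thesis using R_fin by (simp add: potential_def card_Pow)
qed

text \<open>Each round raises the lower bound on the potential of refuting worlds, so after one
  round more than \<open>potential_bound\<close> allows none is left. That \<open>act f\<close>
  fixes the models of \<open>P\<close> expresses that \<open>f\<close> is the identity modulo
  \<open>P\<close>.\<close>

lemma projective:
  "\<exists>f. (\<forall>x. x \<notin> var \<longrightarrow> f x = Atom x) \<and> (\<forall>x\<in>var \<union> par. f x \<in> lang (var \<union> par)) \<and>
    (\<forall>t. pers t \<longrightarrow> t \<tturnstile> E \<longrightarrow> t \<tturnstile> subst f P) \<and> (\<forall>t. pers t \<longrightarrow> t \<tturnstile> P \<longrightarrow> act f t = t)"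
proof -
  obtain as where "set as = Pow var" using finite_list[of "Pow var"] fin by auto
  then have as: "a \<in> set as" if "a \<subseteq> var" for a using that by simp
  have run: "\<forall>u\<in>up (run (concat (replicate n as)) t). \<not> u \<tturnstile> P \<longrightarrow> n \<le> potential u"
    if "pers t" "t \<tturnstile> E" for t n
  proof (induction n)
    case (Suc n)
    have "concat (replicate (Suc n) as) = concat (replicate n as) @ as"
      by (induction n) simp_all
    then show ?case
      using potential_round[OF pers_acts[OF that(1)] _ Suc as] that(2) by (simp add: acts_append run_E)
  qed simp
  define N where "N = Suc (card par + 2 ^ card R)"
  have forced: "run (concat (replicate N as)) t \<tturnstile> P" if "pers t" "t \<tturnstile> E" for t
    using run[OF that, of N] up_refl[of "run (concat (replicate N as)) t"]
      potential_bound[of "run (concat (replicate N as)) t"] unfolding N_def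
    by (metis not_less_eq_eq)
  have "P \<in> lang (var \<union> par)" using P by (simp add: fms_def)
  from acts_subst[OF this, of var "concat (replicate N as)"]
  obtain f where f: "\<forall>x. x \<notin> var \<longrightarrow> f x = Atom x" "\<forall>x\<in>var \<union> par. f x \<in> lang (var \<union> par)"
    "\<forall>t. run (concat (replicate N as)) t = act f t"
    by auto
  have "act f t = t" if "pers t" "t \<tturnstile> P" for t
    using acts_fixed[OF that] f(3) by metis
  moreover have "t \<tturnstile> subst f P" if "pers t" "t \<tturnstile> E" for t
    using forced[OF that] f(3) by (simp add: forces_subst)
  ultimately show ?thesis using f(1,2) by blast
qed

end

section \<open>Finitary unification\<close>

lemma Iff_forces: "t \<tturnstile> B \<^bold>\<longleftrightarrow> C \<longleftrightarrow> (\<forall>s\<in>up t. s \<tturnstile> B \<longleftrightarrow> s \<tturnstile> C)"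
  by auto

lemma substitution_subst:
  assumes "\<And>x. x \<in> par \<Longrightarrow> f x = Atom x" "\<And>x. x \<in> var \<union> par \<Longrightarrow> f x \<in> lang (var \<union> par)"
  shows "substitution var par (subst f)"
  unfolding substitution_def using assms subst_lang[of _ "var \<union> par" f] by auto

text \<open>A substitution is a map on formulas constrained only on the language; there its values
  at variables determine it, which makes \<open>act\<close> applicable.\<close>

lemma substitution_eq_subst:
  assumes "substitution var par \<gamma>" "B \<in> lang (var \<union> par)"
  shows "\<gamma> B = subst (\<lambda>x. if x \<in> var then \<gamma> (Atom x) else Atom x) B"
proof -
  have conn: "\<gamma> \<^bold>\<bottom> = \<^bold>\<bottom>" "\<And>p. p \<in> par \<Longrightarrow> \<gamma> (Atom p) = Atom p"
    "\<And>B C. B \<in> lang (var \<union> par) \<Longrightarrow> C \<in> lang (var \<union> par) \<Longrightarrow>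
      \<gamma> (B \<^bold>\<and> C) = \<gamma> B \<^bold>\<and> \<gamma> C \<and> \<gamma> (B \<^bold>\<or> C) = \<gamma> B \<^bold>\<or> \<gamma> C \<and> \<gamma> (B \<^bold>\<longrightarrow> C) = \<gamma> B \<^bold>\<longrightarrow> \<gamma> C"
    using assms(1) unfolding substitution_def by auto
  show ?thesis using assms(2)
    by (induction B) (use conn in \<open>auto simp: lang_def\<close>)
qed

lemma ext_prop_equiv: "equiv_fm P Q \<Longrightarrow> ext_prop var E P \<Longrightarrow> ext_prop var E Q"
  by (simp add: ext_prop_def equiv_fm_def)

theorem theorem5p7:
  fixes var par :: "'a set" and E :: "'a fm"
  assumes "var \<inter> par = {}"
    and "finite (var \<union> par)"
    and "E \<in> lang par"
  shows "finitary_unification var par E"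
  unfolding finitary_unification_def
proof (intro ballI impI)
  fix A assume A: "A \<in> lang (var \<union> par)"
  define X where "X = var \<union> par"
  \<comment> \<open>A common bound on both depths, fixed before any unifier is considered, so that
    one finite set \<open>R\<close> serves all unifiers.\<close>
  define m where "m = depth A + depth E"
  have Am: "A \<in> fms X (Suc (Suc (Suc m)))" and Em: "E \<in> fms par (Suc (Suc m))"
    using A assms(3) by (auto simp: fms_def X_def m_def)
  obtain R where R: "represents R (fms X (Suc (Suc (Suc m))))"
    using fms_represented[OF assms(2)] unfolding X_def by blast
  obtain R' where R': "represents R' (fms X (Suc (Suc m)))"
    using fms_represented[OF assms(2)] unfolding X_def by blast
  define Q where "Q = {P \<in> R. ext_prop var E P \<and> (\<forall>t. t \<tturnstile> P \<longrightarrow> t \<tturnstile> A)}"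
  have "\<forall>P\<in>Q. \<exists>f. (\<forall>x. x \<notin> var \<longrightarrow> f x = Atom x) \<and> (\<forall>x\<in>X. f x \<in> lang X) \<and>
    (\<forall>t. pers t \<longrightarrow> t \<tturnstile> E \<longrightarrow> t \<tturnstile> subst f P) \<and> (\<forall>t. pers t \<longrightarrow> t \<tturnstile> P \<longrightarrow> act f t = t)"
  proof
    fix P assume "P \<in> Q"
    then have "P \<in> fms X (Suc (Suc (Suc m)))" "ext_prop var E P"
      using R by (auto simp: Q_def represents_def)
    then have "extensible var par E P (Suc (Suc m)) R'"
      using assms R' unfolding X_def by unfold_locales
    then show "\<exists>f. (\<forall>x. x \<notin> var \<longrightarrow> f x = Atom x) \<and> (\<forall>x\<in>X. f x \<in> lang X) \<and>
      (\<forall>t. pers t \<longrightarrow> t \<tturnstile> E \<longrightarrow> t \<tturnstile> subst f P) \<and> (\<forall>t. pers t \<longrightarrow> t \<tturnstile> P \<longrightarrow> act f t = t)"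
      unfolding X_def by (rule extensible.projective)
  qed
  from bchoice[OF this] obtain h where hQ:
    "\<forall>P\<in>Q. (\<forall>x. x \<notin> var \<longrightarrow> h P x = Atom x) \<and> (\<forall>x\<in>X. h P x \<in> lang X) \<and>
      (\<forall>t. pers t \<longrightarrow> t \<tturnstile> E \<longrightarrow> t \<tturnstile> subst (h P) P) \<and> (\<forall>t. pers t \<longrightarrow> t \<tturnstile> P \<longrightarrow> act (h P) t = t)"
    by (elim exE)
  have h: "\<And>P x. P \<in> Q \<Longrightarrow> x \<notin> var \<Longrightarrow> h P x = Atom x"
    "\<And>P x. P \<in> Q \<Longrightarrow> x \<in> X \<Longrightarrow> h P x \<in> lang X"
    "\<And>P t. P \<in> Q \<Longrightarrow> pers t \<Longrightarrow> t \<tturnstile> E \<Longrightarrow> t \<tturnstile> subst (h P) P"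
    "\<And>P t. P \<in> Q \<Longrightarrow> pers t \<Longrightarrow> t \<tturnstile> P \<Longrightarrow> act (h P) t = t"
    using hQ by simp_all
  define \<Theta> where "\<Theta> = (\<lambda>P. subst (h P)) ` Q"
  have "finite \<Theta>" using R by (auto simp: \<Theta>_def Q_def represents_def)
  moreover have "unifier var par E A \<theta>" if "\<theta> \<in> \<Theta>" for \<theta>
  proof -
    obtain P where P: "P \<in> Q" "\<theta> = subst (h P)" using \<open>\<theta> \<in> \<Theta>\<close> by (auto simp: \<Theta>_def)
    have "substitution var par \<theta>"
      unfolding P(2) by (rule substitution_subst) (use h(1,2)[OF P(1)] assms(1) in \<open>auto simp: X_def\<close>)
    moreover have "IPC+E \<turnstile> \<theta> A"
    proof (rule completeness)
      fix t assume "pers t" "t \<tturnstile> E"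
      then have "act (h P) t \<tturnstile> P" using h(3)[OF P(1)] by (simp add: forces_subst)
      then show "t \<tturnstile> \<theta> A" using P by (simp add: Q_def forces_subst)
    qed
    ultimately show ?thesis by (simp add: unifier_def)
  qed
  moreover have "\<exists>\<theta>\<in>\<Theta>. less_general var par E \<gamma> \<theta>" if "unifier var par E A \<gamma>" for \<gamma>
  proof -
    have \<gamma>: "substitution var par \<gamma>" "IPC+E \<turnstile> \<gamma> A" using that by (auto simp: unifier_def)
    define g where "g = (\<lambda>x. if x \<in> var then \<gamma> (Atom x) else Atom x)"
    have \<gamma>_g: "\<gamma> B = subst g B" if "B \<in> lang X" for B
      using substitution_eq_subst[OF \<gamma>(1)] that by (simp add: g_def X_def)
    have "t \<tturnstile> subst g A" if "pers t" "t \<tturnstile> E" for t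
      using soundness[OF \<gamma>(2) that] \<gamma>_g[of A] A by (simp add: X_def)
    moreover have "g x = Atom x" if "x \<in> par" for x using that assms(1) by (auto simp: g_def)
    ultimately obtain P where P: "P \<in> fms X (Suc (Suc (Suc m)))" "ext_prop var E P"
      "\<And>t. t \<tturnstile> P \<Longrightarrow> t \<tturnstile> A" "\<And>t. pers t \<Longrightarrow> t \<tturnstile> E \<Longrightarrow> t \<tturnstile> subst g P"
      using ext_prop_below_unifier[OF assms(2,1) _ Em Am[unfolded X_def], of g]
      unfolding X_def by blast
    \<comment> \<open>\<open>P\<close> was built from \<open>\<gamma>\<close>; an equivalent
      representative brings it into the finite set \<open>Q\<close>.\<close>
    obtain P' where P': "P' \<in> R" "equiv_fm P P'" using R P(1) by (auto simp: represents_def)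
    then have "P' \<in> Q"
      using P(2,3) ext_prop_equiv by (auto simp: Q_def equiv_fm_def)
    \<comment> \<open>\<open>\<gamma>\<close> itself serves as the outer substitution.
      \<open>act g s\<close> forces \<open>P'\<close> and is thus fixed by
      \<open>act (h P')\<close>, so \<open>h P' x\<close> and \<open>x\<close> have the same truth
      value there.\<close>
    have "IPC+E \<turnstile> \<gamma> (Atom x) \<^bold>\<longleftrightarrow> (\<gamma> \<circ> subst (h P')) (Atom x)" if "x \<in> var" for x
    proof (rule completeness)
      fix t assume t: "pers t" "t \<tturnstile> E"
      have "s \<tturnstile> \<gamma> (Atom x) \<longleftrightarrow> s \<tturnstile> \<gamma> (h P' x)" if "s \<in> up t" for s
      proof -
        have "pers s" "s \<tturnstile> E" using t that pers_up forces_up by blast+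
        then have "act g s \<tturnstile> P'" using P(4) P'(2) by (simp add: forces_subst equiv_fm_def)
        then have "act (h P') (act g s) = act g s" using h(4)[OF \<open>P' \<in> Q\<close>] pers_act \<open>pers s\<close> by blast
        then have "act g s \<tturnstile> h P' x \<longleftrightarrow> x \<in> lab (act g s)"
          using lab_act[of "h P'" "act g s"] by auto
        moreover have "\<gamma> (h P' x) = subst g (h P' x)"
          using \<gamma>_g h(2)[OF \<open>P' \<in> Q\<close>] \<open>x \<in> var\<close> by (simp add: X_def)
        ultimately show ?thesis using \<open>x \<in> var\<close> by (simp add: forces_subst g_def)
      qed
      then show "t \<tturnstile> \<gamma> (Atom x) \<^bold>\<longleftrightarrow> (\<gamma> \<circ> subst (h P')) (Atom x)"
        unfolding Iff_forces by simp
    qed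
    then have "less_general var par E \<gamma> (subst (h P'))"
      using \<gamma>(1) unfolding less_general_def by blast
    then show ?thesis using \<open>P' \<in> Q\<close> by (auto simp: \<Theta>_def)
  qed
  ultimately show "\<exists>\<Theta>. finite \<Theta> \<and> complete_unifiers var par E A \<Theta>"
    unfolding complete_unifiers_def by blast
qed

end
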